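(* Let $k,n$ be positive integers, let $\mathcal{G}_k$ be the finite set of all labeled, undirected (simple) graphs with $k$ vertices, let $z:\mathcal{G}_k\to\mathbb{R}^n$ be a function, and let $t\in\mathbb{R}^n$. Let $C$ be the convex hull of $z(\mathcal{G}_k)$ in $\mathbb{R}^n$, and let $V = \mathrm{span}(\{z(g_1)-z(g_2) \mid g_1,g_2\in\mathcal{G}_k\})$ and $V^{\perp}=\{u\in\mathbb{R}^n \mid u\cdot v=0 \text{ for all } v\in V\}$. For $\theta\in\mathbb{R}^n$ put $$L(\theta)=\frac{e^{\theta\cdot t}}{\sum_{\bar g\in\mathcal{G}_k}e^{\theta\cdot z(\bar g)}},\qquad \ell(\theta)=\ln(L(\theta)).$$ If $\dim(C)=n$, then (1) $\ell$ is strictly concave on $\mathbb{R}^n$; and (2) there exists $\hat\theta\in\mathbb{R}^n$ such that $L(\hat\theta)=\sup_{\theta\in\mathbb{R}^n}L(\theta)$ if and only if $t$ is in the interior of $C$; furthermore, such a $\hat\theta$ (when it exists) is unique. If $\dim(C)<n$, then (3) $\ell$ is concave but not strictly concave on $\mathbb{R}^n$; (4) there exists $\hat\theta\in V$ such that $L(\hat\theta)=\sup_{\theta\in\mathbb{R}^n}L(\theta)$ if and only if $t$ is in the relative interior of $C$; furthermore, such a $\hat\theta$ in $V$ (when it exists) is unique; and (5) $L(\theta)=L(\theta+u)$ for all $\theta\in\mathbb{R}^n$ and $u\in V^{\perp}$.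
   Context: "Labeled" means that isomorphic graphs are not identified. The dimension $\dim(C)$ is the dimension of the affine hull of $C$ (equivalently, $\dim V$). If $v_1,\dots,v_m$ are the vertices (extreme points) of $C$, the relative interior of $C$ is $\mathrm{rint}(C)=\{\sum_{i=1}^m\lambda_i v_i \mid \lambda_i>0 \text{ for all } i,\ \sum_{i=1}^m\lambda_i=1\}$. A function $f:\mathbb{R}^n\to\mathbb{R}$ is concave if $f(sx_1+(1-s)x_2)\ge s f(x_1)+(1-s)f(x_2)$ for all $x_1\ne x_2$ in $\mathbb{R}^n$ and $s\in(0,1)$, and strictly concave if the strict inequality always holds. The supremum of $L$ is taken in $(0,\infty]$.
   Formalization: Item (5) is proved only for t in the affine hull of C; for other t it is false (e.g. k=n=1, z=0, t=1 gives L(θ)=e^θ with V^⊥=ℝ), and this condition is exactly necessary and sufficient. *)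

theory Defs
  imports "HOL-Analysis.Analysis"
begin

(* The vertex set is fixed to {1..k} and isomorphic graphs are not identified, so a
   labeled simple graph is given by its edge set, a set of two-element sets of vertices. *)

definition labeled_graphs :: "nat \<Rightarrow> nat set set set" where
  "labeled_graphs k = {E. E \<subseteq> {e. e \<subseteq> {1..k} \<and> card e = 2}}"

definition strictly_concave :: "('a::real_vector \<Rightarrow> real) \<Rightarrow> bool" where
  "strictly_concave f \<longleftrightarrow>
     (\<forall>x y s. x \<noteq> y \<longrightarrow> 0 < s \<longrightarrow> s < 1 \<longrightarrow>
        f (s *\<^sub>R x + (1 - s) *\<^sub>R y) > s * f x + (1 - s) * f y)"

(* For a polytope, rel_interior is the set of all strictly positive convex combinations
   of the vertices. *)

lemma polytope_rel_interior_vertices: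
  fixes C :: "'a::euclidean_space set"
  assumes "polytope C"
  defines "X \<equiv> {v. v extreme_point_of C}"
  shows "rel_interior C =
    {\<Sum>v\<in>X. c v *\<^sub>R v | c. (\<forall>v\<in>X. c v > 0) \<and> sum c X = 1}"
proof -
  from \<open>polytope C\<close> obtain S where S: "finite S" "C = convex hull S"
    unfolding polytope_def by blast
  have C: "C = convex hull X"
    unfolding X_def using S Krein_Milman_polytope by blast
  have "X \<subseteq> S"
    unfolding X_def using S extreme_points_of_convex_hull by blast
  with S have "finite X"
    using finite_subset by blast
  note * = rel_interior_convex_hull_union [of X "\<lambda>x. {x}", OF this]
  have "rel_interior (convex hull X) =
      {\<Sum>v\<in>X. c v *\<^sub>R v | c. (\<forall>v\<in>X. c v > 0) \<and> sum c X = 1}" (is "_ = ?R")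
  proof
    show "rel_interior (convex hull X) \<subseteq> ?R"
    proof
      fix x assume "x \<in> rel_interior (convex hull X)"
      then have "x \<in> rel_interior (convex hull (\<Union>v\<in>X. {v}))" by simp
      then obtain c s where cs: "x = (\<Sum>v\<in>X. c v *\<^sub>R s v)" "\<forall>v\<in>X. c v > 0" "sum c X = 1"
        "\<forall>v\<in>X. s v \<in> rel_interior {v}"
        using * by auto
      have "(\<Sum>v\<in>X. c v *\<^sub>R s v) = (\<Sum>v\<in>X. c v *\<^sub>R v)"
        using cs(4) by (intro sum.cong) auto
      with cs show "x \<in> ?R" by blast
    qed
    show "?R \<subseteq> rel_interior (convex hull X)"
      using explicit_subset_rel_interior_convex_hull_minimal [OF \<open>finite X\<close>] by blast
  qed
  with C show ?thesis by simp
qed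

end

(* With F \<theta> = (\<Sum>g. exp (\<theta> \<bullet> (z g - t))) one has L = 1 / F. Applying convexity of exp to the
   normalised exponents x \<bullet> (z g - t) - ln (F x) and y \<bullet> (z g - t) - ln (F y) and summing over g
   gives convexity of ln F, strict unless x - y is orthogonal to V. At a minimiser of F the
   gradient vanishes, which exhibits t as a convex combination of the z g with strictly positive
   weights, that is, as a point of the relative interior. Conversely such a combination bounds
   every \<theta> \<bullet> (z g - t) from both sides on a sublevel set of F, so F restricted to V has compact
   sublevel sets and attains its minimum; if t lies in the affine hull, F is invariant under
   translation by vectors orthogonal to V, and the minimum over V is global. *)

theory Submission
  imports Defs
begin

text \<open>The supremum lives in \<open>ereal\<close>, where it always exists, so attaining it
  means exactly being a global maximiser, with no boundedness condition.\<close>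

lemma ereal_eq_SUP_iff:
  fixes f :: "'a \<Rightarrow> real"
  shows "ereal (f x) = (SUP y. ereal (f y)) \<longleftrightarrow> (\<forall>y. f y \<le> f x)"
proof
  assume "ereal (f x) = (SUP y. ereal (f y))"
  then have "ereal (f y) \<le> ereal (f x)" for y
    using SUP_upper[of y UNIV "\<lambda>y. ereal (f y)"] by simp
  then show "\<forall>y. f y \<le> f x" by simp
next
  assume "\<forall>y. f y \<le> f x"
  then show "ereal (f x) = (SUP y. ereal (f y))"
    by (intro antisym SUP_upper SUP_least) auto
qed

text \<open>The tangent inequality \<open>1 + x < exp x\<close> for nonzero \<open>x\<close> is
  applied at the deviations of \<open>a\<close> and \<open>b\<close> from their weighted mean
  \<open>m\<close>. The linear terms average out to zero, and multiplication by \<open>exp m\<close>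
  undoes the shift.\<close>

lemma exp_strictly_convex:
  fixes a b s :: real
  assumes "0 < s" "s < 1" "a \<noteq> b"
  shows "exp (s * a + (1 - s) * b) < s * exp a + (1 - s) * exp b"
proof -
  define m where "m = s * a + (1 - s) * b"
  have tangent: "1 + x < exp x" if "x \<noteq> 0" for x :: real
  proof -
    have "exp x \<noteq> 1 + x"
      using ln_eq_minus_one[of "exp x"] that by auto
    then show ?thesis
      using exp_ge_add_one_self[of x] by linarith
  qed
  have am: "a - m = (1 - s) * (a - b)" and bm: "b - m = - s * (a - b)"
    unfolding m_def by (simp_all add: algebra_simps)
  have "a - m \<noteq> 0" "b - m \<noteq> 0"
    unfolding am bm using assms by auto
  then have "s * (1 + (a - m)) < s * exp (a - m)" "(1 - s) * (1 + (b - m)) < (1 - s) * exp (b - m)"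
    using tangent assms by auto
  moreover have "s * (1 + (a - m)) + (1 - s) * (1 + (b - m)) = 1"
    unfolding am bm by (simp add: algebra_simps)
  ultimately have "exp m * 1 < exp m * (s * exp (a - m) + (1 - s) * exp (b - m))"
    by (intro mult_strict_left_mono) auto
  then show ?thesis
    unfolding m_def[symmetric] distrib_left mult.left_commute[of "exp m"] by (simp add: exp_add[symmetric])
qed

section \<open>Finite exponential families and their direction space\<close>

locale exponential_family =
  fixes A :: "'i set" and z :: "'i \<Rightarrow> 'a::euclidean_space" and t :: 'a
  assumes finite_A: "finite A" and A_nonempty: "A \<noteq> {}"
begin

text \<open>The space V of the theorem: the linear subspace parallel to the affine hull of the
  points \<open>z g\<close>.\<close>

definition directions :: "'a set" where
  "directions = span {z g - z h | g h. g \<in> A \<and> h \<in> A}"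

text \<open>The function F of the overview: the usual normalising sum with the statistics recentred
  at \<open>t\<close>, so that maximising the likelihood becomes minimising a sum of
  exponentials.\<close>

definition partition_fn :: "'a \<Rightarrow> real" where
  "partition_fn \<theta> = (\<Sum>g\<in>A. exp (\<theta> \<bullet> (z g - t)))"

lemma partition_fn_pos: "partition_fn \<theta> > 0"
  unfolding partition_fn_def using finite_A A_nonempty by (intro sum_pos) auto

lemma likelihood_eq:
  "exp (\<theta> \<bullet> t) / (\<Sum>g\<in>A. exp (\<theta> \<bullet> z g)) = inverse (partition_fn \<theta>)"
proof -
  have "partition_fn \<theta> = (\<Sum>g\<in>A. exp (\<theta> \<bullet> z g)) / exp (\<theta> \<bullet> t)"
    unfolding partition_fn_def sum_divide_distrib by (simp add: inner_diff_right exp_diff)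
  then show ?thesis by simp
qed

lemma diff_in_directions: "g \<in> A \<Longrightarrow> h \<in> A \<Longrightarrow> z g - z h \<in> directions"
  unfolding directions_def by (intro span_base) auto

text \<open>Every difference \<open>z g - z g'\<close> is a difference of two differences from the
  base point \<open>z h\<close>. The form with one base point is the one that the library results on
  affine hulls and dimension speak about.\<close>

lemma directions_eq_span_translate:
  assumes "h \<in> A"
  shows "directions = span ((\<lambda>x. x - z h) ` (z ` A))"
proof
  show "span ((\<lambda>x. x - z h) ` (z ` A)) \<subseteq> directions"
    unfolding directions_def using assms by (intro span_mono) auto
  have "z g - z g' \<in> span ((\<lambda>x. x - z h) ` (z ` A))" if "g \<in> A" "g' \<in> A" for g g'
  proof -
    have "(z g - z h) - (z g' - z h) \<in> span ((\<lambda>x. x - z h) ` (z ` A))"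
      using that by (intro span_diff span_base) auto
    then show ?thesis by simp
  qed
  then show "directions \<subseteq> span ((\<lambda>x. x - z h) ` (z ` A))"
    unfolding directions_def by (intro span_minimal) auto
qed

lemma dim_directions: "int (dim directions) = aff_dim (convex hull (z ` A))"
proof -
  obtain h where "h \<in> A" using A_nonempty by auto
  have "aff_dim (z ` A) = int (dim ((\<lambda>x. x - z h) ` (z ` A)))"
    using \<open>h \<in> A\<close> aff_dim_eq_dim_subtract[of "z h" "z ` A"] by (simp add: hull_inc)
  then show ?thesis
    by (simp add: directions_eq_span_translate[OF \<open>h \<in> A\<close>] aff_dim_convex_hull)
qed

lemma diff_observation_in_directions:
  assumes "t \<in> affine hull (convex hull (z ` A))" "g \<in> A"
  shows "z g - t \<in> directions"
proof -
  have "t - z g \<in> (\<lambda>x. x - z g) ` (affine hull (z ` A))"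
    using assms by (auto simp: affine_hull_convex_hull)
  then have "t - z g \<in> directions"
    using diffs_affine_hull_span[of "z g" "z ` A"] directions_eq_span_translate assms(2) by auto
  then have "- (t - z g) \<in> directions"
    unfolding directions_def by (rule span_neg)
  then show ?thesis by simp
qed

text \<open>The hypothesis makes the functional of \<open>u\<close> vanish on the generators, and
  its kernel is a subspace. The later uses take \<open>v\<close> to be \<open>u\<close> itself,
  which forces \<open>u\<close> to be zero.\<close>

lemma orthogonal_to_directions:
  assumes "\<And>g h. g \<in> A \<Longrightarrow> h \<in> A \<Longrightarrow> u \<bullet> z g = u \<bullet> z h" "v \<in> directions"
  shows "u \<bullet> v = 0"
proof -
  have "directions \<subseteq> {v. u \<bullet> v = 0}"
    unfolding directions_def
    by (intro span_minimal subspace_hyperplane) (auto simp: inner_diff_right dest: assms(1))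
  then show ?thesis using assms(2) by auto
qed

lemma orthogonal_comp_directionsD:
  assumes "u \<in> directions\<^sup>\<bottom>" "v \<in> directions"
  shows "u \<bullet> v = 0"
  using assms by (auto simp: orthogonal_comp_def orthogonal_def inner_commute)

text \<open>With \<open>t\<close> in the affine hull, each \<open>z g - t\<close> is a direction, so
  moving by \<open>u\<close> changes no exponent.\<close>

lemma partition_fn_invariant:
  assumes "t \<in> affine hull (convex hull (z ` A))" "u \<in> directions\<^sup>\<bottom>"
  shows "partition_fn (\<theta> + u) = partition_fn \<theta>"
  unfolding partition_fn_def
  using orthogonal_comp_directionsD[OF assms(2) diff_observation_in_directions[OF assms(1)]]
  by (intro sum.cong) (auto simp: inner_add_left)

section \<open>Convexity of the logarithm of the partition function\<close>

lemma sum_normalised: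
  "(\<Sum>g\<in>A. exp (x \<bullet> (z g - t) - ln (partition_fn x))) = 1"
proof -
  have "(\<Sum>g\<in>A. exp (x \<bullet> (z g - t) - ln (partition_fn x))) = partition_fn x / partition_fn x"
    by (simp add: exp_diff partition_fn_pos sum_divide_distrib[symmetric] partition_fn_def[symmetric])
  then show ?thesis
    using partition_fn_pos[of x] by simp
qed

text \<open>The exponents are linear in the parameter, so the interpolated parameter appears inside
  the sum and the two normalisers combine into one constant factor.\<close>

lemma sum_interpolated:
  "(\<Sum>g\<in>A. exp (s * (x \<bullet> (z g - t) - ln (partition_fn x))
      + (1 - s) * (y \<bullet> (z g - t) - ln (partition_fn y))))
   = exp (ln (partition_fn (s *\<^sub>R x + (1 - s) *\<^sub>R y))
      - (s * ln (partition_fn x) + (1 - s) * ln (partition_fn y)))"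
    (is "(\<Sum>g\<in>A. exp (?e g)) = exp (ln (partition_fn ?m) - ?c)")
proof -
  have "exp (?e g) = exp (?m \<bullet> (z g - t)) / exp ?c" for g
    unfolding exp_diff[symmetric] by (simp add: algebra_simps inner_add_left)
  then show ?thesis
    by (simp add: sum_divide_distrib[symmetric] partition_fn_def[of ?m, symmetric]
        exp_diff partition_fn_pos)
qed

lemma ln_partition_fn_convex:
  assumes "0 \<le> s" "s \<le> 1"
  shows "ln (partition_fn (s *\<^sub>R x + (1 - s) *\<^sub>R y))
    \<le> s * ln (partition_fn x) + (1 - s) * ln (partition_fn y)"
proof -
  have "exp (ln (partition_fn (s *\<^sub>R x + (1 - s) *\<^sub>R y))
      - (s * ln (partition_fn x) + (1 - s) * ln (partition_fn y)))
    \<le> (\<Sum>g\<in>A. s * exp (x \<bullet> (z g - t) - ln (partition_fn x))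
      + (1 - s) * exp (y \<bullet> (z g - t) - ln (partition_fn y)))"
    \<comment> \<open>\<open>convex_onD\<close> attaches its parameter to the second point, hence
      \<open>1 - s\<close>.\<close>
    unfolding sum_interpolated[symmetric] using assms using convex_onD[OF exp_convex, of "1 - s"]
    by (intro sum_mono) simp
  also have "\<dots> = exp 0"
    by (simp add: sum.distrib sum_distrib_left[symmetric] sum_normalised)
  finally show ?thesis by simp
qed

lemma ln_partition_fn_strictly_convex:
  assumes "x \<noteq> y" "x - y \<in> directions" "0 < s" "s < 1"
  shows "ln (partition_fn (s *\<^sub>R x + (1 - s) *\<^sub>R y))
    < s * ln (partition_fn x) + (1 - s) * ln (partition_fn y)"
proof -
  let ?p = "\<lambda>x g. x \<bullet> (z g - t) - ln (partition_fn x)"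
  \<comment> \<open>If all normalised exponents agreed, \<open>x - y\<close> would have the same
    inner product with every \<open>z g\<close>, hence be orthogonal to all directions, among them
    itself.\<close>
  have "\<exists>g\<in>A. ?p x g \<noteq> ?p y g"
  proof (rule ccontr)
    assume "\<not> ?thesis"
    then have "(x - y) \<bullet> z g = (x - y) \<bullet> t + ln (partition_fn x) - ln (partition_fn y)" if "g \<in> A" for g
      using that by (force simp: inner_diff_left inner_diff_right)
    then have "(x - y) \<bullet> (x - y) = 0"
      using assms(2) by (intro orthogonal_to_directions) auto
    then show False using assms(1) by simp
  qed
  then have "\<exists>g\<in>A. exp (s * ?p x g + (1 - s) * ?p y g) < s * exp (?p x g) + (1 - s) * exp (?p y g)"
    using exp_strictly_convex[OF assms(3,4)] by blast
  then have "exp (ln (partition_fn (s *\<^sub>R x + (1 - s) *\<^sub>R y))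
      - (s * ln (partition_fn x) + (1 - s) * ln (partition_fn y)))
    < (\<Sum>g\<in>A. s * exp (?p x g) + (1 - s) * exp (?p y g))"
    unfolding sum_interpolated[symmetric]
    using finite_A convex_onD[OF exp_convex, of "1 - s"] assms(3,4)
    by (intro sum_strict_mono_ex1) auto
  also have "\<dots> = exp 0"
    by (simp add: sum.distrib sum_distrib_left[symmetric] sum_normalised)
  finally show ?thesis by simp
qed

text \<open>All \<open>z g\<close> have the same inner product with \<open>u\<close>, so a common
  factor leaves the sum. Thus the logarithm is affine along \<open>u\<close>, wherever
  \<open>t\<close> lies; this is what later rules out strict concavity.\<close>

lemma ln_partition_fn_add_orthogonal:
  assumes "u \<in> directions\<^sup>\<bottom>" "h \<in> A"
  shows "ln (partition_fn (\<theta> + u)) = ln (partition_fn \<theta>) + u \<bullet> (z h - t)"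
proof -
  have "exp ((\<theta> + u) \<bullet> (z g - t)) = exp (u \<bullet> (z h - t)) * exp (\<theta> \<bullet> (z g - t))" if "g \<in> A" for g
    using orthogonal_comp_directionsD[OF assms(1) diff_in_directions[OF that assms(2)]]
    by (simp add: exp_add[symmetric] inner_add_left inner_diff_right)
  then have "partition_fn (\<theta> + u) = exp (u \<bullet> (z h - t)) * partition_fn \<theta>"
    unfolding partition_fn_def sum_distrib_left by (intro sum.cong) auto
  then show ?thesis
    using partition_fn_pos[of \<theta>] by (simp add: ln_mult_pos)
qed

text \<open>By strict convexity, the midpoint of two distinct minimisers would lie strictly below
  the minimum.\<close>

lemma minimiser_unique:
  assumes "\<And>\<eta>. partition_fn x \<le> partition_fn \<eta>" "\<And>\<eta>. partition_fn y \<le> partition_fn \<eta>"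
    and "x - y \<in> directions"
  shows "x = y"
proof (rule ccontr)
  assume "x \<noteq> y"
  have "partition_fn x = partition_fn y"
    using assms by (simp add: antisym)
  moreover have "ln (partition_fn x) \<le> ln (partition_fn ((1/2) *\<^sub>R x + (1 - 1/2) *\<^sub>R y))"
    using assms(1) by (simp add: partition_fn_pos)
  ultimately show False
    using ln_partition_fn_strictly_convex[OF \<open>x \<noteq> y\<close> assms(3), of "1/2"] by simp
qed

section \<open>Relative interior and existence of minimisers\<close>

text \<open>The weights run over all indices rather than over extreme points, because the gradient
  condition yields a weight for every index; \<open>z\<close> may repeat values or hit points that
  are not extreme. The hull is treated as that of a union of singletons, each its own relative
  interior.\<close>

lemma rel_interior_hull:
  "rel_interior (convex hull (z ` A)) =
    {\<Sum>g\<in>A. c g *\<^sub>R z g | c. (\<forall>g\<in>A. c g > 0) \<and> sum c A = 1}" (is "_ = ?R")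
proof -
  have "rel_interior (convex hull (z ` A)) =
    {\<Sum>g\<in>A. c g *\<^sub>R s g | c s. (\<forall>g\<in>A. c g > 0) \<and> sum c A = 1 \<and>
      (\<forall>g\<in>A. s g \<in> rel_interior {z g})}"
    using rel_interior_convex_hull_union[OF finite_A, of "\<lambda>g. {z g}"]
    by (simp add: UNION_singleton_eq_range)
  also have "\<dots> = ?R"
  proof (intro subset_antisym subsetI)
    fix x assume "x \<in> {\<Sum>g\<in>A. c g *\<^sub>R s g | c s. (\<forall>g\<in>A. c g > 0) \<and> sum c A = 1 \<and>
      (\<forall>g\<in>A. s g \<in> rel_interior {z g})}"
    then obtain c s where cs: "x = (\<Sum>g\<in>A. c g *\<^sub>R s g)" "\<forall>g\<in>A. c g > 0" "sum c A = 1"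
      "\<forall>g\<in>A. s g = z g" by auto
    moreover have "(\<Sum>g\<in>A. c g *\<^sub>R s g) = (\<Sum>g\<in>A. c g *\<^sub>R z g)"
      using cs(4) by (intro sum.cong) auto
    ultimately show "x \<in> ?R" by blast
  next
    fix x assume "x \<in> ?R"
    then show "x \<in> {\<Sum>g\<in>A. c g *\<^sub>R s g | c s. (\<forall>g\<in>A. c g > 0) \<and> sum c A = 1 \<and>
      (\<forall>g\<in>A. s g \<in> rel_interior {z g})}" by fastforce
  qed
  finally show ?thesis .
qed

lemma minimiser_imp_rel_interior:
  assumes min: "\<And>\<eta>. partition_fn \<theta> \<le> partition_fn \<eta>"
  shows "t \<in> rel_interior (convex hull (z ` A))"
proof -
  \<comment> \<open>These are the probabilities of the family at the parameter \<theta>; the claim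
    is that their mean is \<open>t\<close>.\<close>
  define c where "c = (\<lambda>g. exp (\<theta> \<bullet> (z g - t)) / partition_fn \<theta>)"
  have c_pos: "\<forall>g\<in>A. c g > 0"
    unfolding c_def by (simp add: partition_fn_pos)
  have c_sum: "sum c A = 1"
    unfolding c_def sum_divide_distrib[symmetric] partition_fn_def[symmetric]
    using partition_fn_pos[of \<theta>] by simp
  \<comment> \<open>This is the gradient of \<open>partition_fn\<close> at \<theta>. Differentiating
    along \<open>v\<close> itself gives \<open>v \<bullet> v\<close>, so one directional derivative
    suffices.\<close>
  define v where "v = (\<Sum>g\<in>A. exp (\<theta> \<bullet> (z g - t)) *\<^sub>R (z g - t))"
  have "((\<lambda>s. partition_fn (\<theta> + s *\<^sub>R v)) has_real_derivative
      (\<Sum>g\<in>A. exp ((\<theta> + 0 *\<^sub>R v) \<bullet> (z g - t)) * (v \<bullet> (z g - t)))) (at 0)"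
    unfolding partition_fn_def inner_add_left inner_scaleR_left
    by (rule DERIV_sum) (auto intro!: derivative_eq_intros)
  then have "(\<Sum>g\<in>A. exp ((\<theta> + 0 *\<^sub>R v) \<bullet> (z g - t)) * (v \<bullet> (z g - t))) = 0"
    by (rule DERIV_local_min[where d = 1]) (auto simp: min)
  then have "v \<bullet> v = 0"
    by (subst (2) v_def) (simp add: inner_sum_right)
  then have "v = 0" by simp
  have "(\<Sum>g\<in>A. c g *\<^sub>R z g) - t = (\<Sum>g\<in>A. c g *\<^sub>R z g) - (\<Sum>g\<in>A. c g) *\<^sub>R t"
    using c_sum by simp
  also have "\<dots> = (\<Sum>g\<in>A. c g *\<^sub>R (z g - t))"
    by (simp add: scaleR_sum_left sum_subtractf[symmetric] scaleR_diff_right)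
  also have "\<dots> = inverse (partition_fn \<theta>) *\<^sub>R v"
    unfolding c_def v_def scaleR_sum_right by (simp add: divide_inverse mult.commute)
  finally have "t = (\<Sum>g\<in>A. c g *\<^sub>R z g)"
    using \<open>v = 0\<close> by simp
  with c_pos c_sum show ?thesis
    unfolding rel_interior_hull by blast
qed

text \<open>The right-hand side is a seminorm that is positive on nonzero directions: where it
  vanishes, \<theta> has constant inner product with all \<open>z g\<close> and so is orthogonal to
  itself. Its minimum on the compact unit sphere of \<open>directions\<close> serves as
  \<open>m\<close>, and scaling does the rest.\<close>

lemma norm_le_sum_inner_on_directions:
  obtains m where "m > 0"
    "\<And>\<theta>. \<theta> \<in> directions \<Longrightarrow> m * norm \<theta> \<le> (\<Sum>g\<in>A. \<bar>\<theta> \<bullet> (z g - t)\<bar>)"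
proof -
  define q where "q = (\<lambda>\<theta>. \<Sum>g\<in>A. \<bar>\<theta> \<bullet> (z g - t)\<bar>)"
  define S where "S = sphere 0 1 \<inter> directions"
  have closed: "closed directions"
    unfolding directions_def by (rule closed_span)
  have "compact S"
    unfolding S_def by (intro compact_Int_closed compact_sphere closed)
  have scale: "q (a *\<^sub>R \<theta>) = \<bar>a\<bar> * q \<theta>" for a \<theta>
    unfolding q_def by (simp add: abs_mult sum_distrib_left)
  have q_pos: "q \<theta> > 0" if "\<theta> \<in> S" for \<theta>
  proof (rule ccontr)
    assume "\<not> q \<theta> > 0"
    then have "q \<theta> = 0"
      unfolding q_def by (meson sum_nonneg abs_ge_zero antisym not_less)
    then have "\<forall>g\<in>A. \<theta> \<bullet> (z g - t) = 0"
      unfolding q_def using finite_A by (simp add: sum_nonneg_eq_0_iff)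
    then have "\<theta> \<bullet> \<theta> = 0"
      using that unfolding S_def
      by (intro orthogonal_to_directions) (auto simp: inner_diff_right)
    then show False
      using that by (auto simp: S_def)
  qed
  have "\<exists>m>0. \<forall>\<theta>\<in>S. m \<le> q \<theta>"
  proof (cases "S = {}")
    case True
    \<comment> \<open>The sphere is empty when \<open>directions\<close> is trivial; any positive
      constant then serves.\<close>
    then show ?thesis by (intro exI[of _ 1]) auto
  next
    case False
    have "continuous_on S q"
      unfolding q_def by (intro continuous_intros)
    then obtain x where "x \<in> S" "\<forall>y\<in>S. q x \<le> q y"
      using continuous_attains_inf \<open>compact S\<close> False by blast
    then show ?thesis using q_pos by blast
  qed
  then obtain m where m: "m > 0" "\<And>\<theta>. \<theta> \<in> S \<Longrightarrow> m \<le> q \<theta>" by blast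
  have "m * norm \<theta> \<le> q \<theta>" if "\<theta> \<in> directions" for \<theta>
  proof (cases "\<theta> = 0")
    case True
    then show ?thesis by (simp add: q_def)
  next
    case False
    then have "inverse (norm \<theta>) *\<^sub>R \<theta> \<in> S"
      using that unfolding S_def directions_def by (auto intro: span_scale)
    then have "m \<le> inverse (norm \<theta>) * q \<theta>"
      using m(2) scale by fastforce
    then show ?thesis
      using False by (simp add: field_simps)
  qed
  with m(1) show thesis
    using that unfolding q_def by blast
qed

text \<open>Each term is at most the whole sum, which bounds the exponents above. Their average with
  the positive weights \<open>c\<close> is zero, so a very negative exponent could not be balanced
  by the others.\<close>

lemma sublevel_bound:
  assumes "t \<in> rel_interior (convex hull (z ` A))"
  obtains B where "\<And>\<theta> g. partition_fn \<theta> \<le> partition_fn 0 \<Longrightarrow> g \<in> A \<Longrightarrow> \<bar>\<theta> \<bullet> (z g - t)\<bar> \<le> B"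
proof -
  obtain c where c: "t = (\<Sum>g\<in>A. c g *\<^sub>R z g)" "\<forall>g\<in>A. c g > 0" "sum c A = 1"
    using assms unfolding rel_interior_hull by blast
  have "(\<Sum>g\<in>A. c g *\<^sub>R (z g - t)) = (\<Sum>g\<in>A. c g *\<^sub>R z g) - (\<Sum>g\<in>A. c g) *\<^sub>R t"
    by (simp add: scaleR_sum_left sum_subtractf scaleR_diff_right)
  then have balanced: "(\<Sum>g\<in>A. c g *\<^sub>R (z g - t)) = 0"
    using c by simp
  define M where "M = ln (partition_fn 0)"
  have "partition_fn 0 = real (card A)"
    unfolding partition_fn_def by simp
  then have "M \<ge> 0"
    unfolding M_def using finite_A A_nonempty by (simp add: card_gt_0_iff Suc_leI)
  have upper: "\<theta> \<bullet> (z g - t) \<le> M" if "partition_fn \<theta> \<le> partition_fn 0" "g \<in> A" for \<theta> g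
  proof -
    have "exp (\<theta> \<bullet> (z g - t)) \<le> partition_fn \<theta>"
      unfolding partition_fn_def using that(2) finite_A by (intro member_le_sum) auto
    then have "exp (\<theta> \<bullet> (z g - t)) \<le> exp M"
      using that(1) by (simp add: M_def partition_fn_pos)
    then show ?thesis by simp
  qed
  have lower: "- (M / c g) \<le> \<theta> \<bullet> (z g - t)" if "partition_fn \<theta> \<le> partition_fn 0" "g \<in> A" for \<theta> g
  proof -
    have "0 = \<theta> \<bullet> (\<Sum>g\<in>A. c g *\<^sub>R (z g - t))"
      by (simp add: balanced)
    also have "\<dots> = (\<Sum>h\<in>A. c h * (\<theta> \<bullet> (z h - t)))"
      by (simp add: inner_sum_right)
    also have "\<dots> = c g * (\<theta> \<bullet> (z g - t)) + (\<Sum>h\<in>A-{g}. c h * (\<theta> \<bullet> (z h - t)))"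
      using finite_A that(2) by (rule sum.remove)
    also have "(\<Sum>h\<in>A-{g}. c h * (\<theta> \<bullet> (z h - t))) \<le> (\<Sum>h\<in>A-{g}. c h * M)"
      using c(2) upper[OF that(1)] by (intro sum_mono mult_left_mono) (auto simp: less_imp_le)
    \<comment> \<open>The missing term may be restored because \<open>M\<close> is nonnegative; the
      weights then sum to 1.\<close>
    also have "\<dots> \<le> (\<Sum>h\<in>A. c h * M)"
      using finite_A c(2) \<open>M \<ge> 0\<close> by (intro sum_mono2) (auto simp: less_imp_le)
    also have "\<dots> = M"
      by (simp add: sum_distrib_right[symmetric] c(3))
    finally show ?thesis
      using c(2) that(2) by (simp add: field_simps)
  qed
  \<comment> \<open>The sum dominates each lower bound \<open>M / c g\<close>, making the bound
    independent of \<open>g\<close>.\<close>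
  define B where "B = M + (\<Sum>g\<in>A. M / c g)"
  have "\<bar>\<theta> \<bullet> (z g - t)\<bar> \<le> B" if "partition_fn \<theta> \<le> partition_fn 0" "g \<in> A" for \<theta> g
  proof -
    have "M / c g \<le> (\<Sum>g\<in>A. M / c g)"
      using finite_A that(2) c(2) \<open>M \<ge> 0\<close> by (intro member_le_sum) (auto simp: less_imp_le)
    moreover have "0 \<le> M / c g"
      using c(2) that(2) \<open>M \<ge> 0\<close> by (simp add: less_imp_le)
    ultimately show ?thesis
      using upper[OF that] lower[OF that] \<open>M \<ge> 0\<close> unfolding B_def by linarith
  qed
  then show thesis using that by blast
qed

lemma rel_interior_imp_minimiser:
  assumes t: "t \<in> rel_interior (convex hull (z ` A))"
  shows "\<exists>\<theta>\<in>directions. \<forall>\<eta>. partition_fn \<theta> \<le> partition_fn \<eta>"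
proof -
  obtain B where B: "\<And>\<theta> g. partition_fn \<theta> \<le> partition_fn 0 \<Longrightarrow> g \<in> A \<Longrightarrow> \<bar>\<theta> \<bullet> (z g - t)\<bar> \<le> B"
    using sublevel_bound[OF t] by blast
  obtain m where m: "m > 0"
    "\<And>\<theta>. \<theta> \<in> directions \<Longrightarrow> m * norm \<theta> \<le> (\<Sum>g\<in>A. \<bar>\<theta> \<bullet> (z g - t)\<bar>)"
    using norm_le_sum_inner_on_directions by blast
  have cont: "continuous_on UNIV partition_fn"
    unfolding partition_fn_def by (intro continuous_intros)
  \<comment> \<open>Outside \<open>K\<close> but inside \<open>directions\<close>, values exceed the
    value at 0, which is itself in \<open>K\<close>; a minimum over \<open>K\<close> is therefore
    one over \<open>directions\<close>.\<close>
  define K where "K = directions \<inter> {\<theta>. partition_fn \<theta> \<le> partition_fn 0}"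
  have "bounded K"
  proof (rule boundedI)
    fix \<theta> assume "\<theta> \<in> K"
    then have "m * norm \<theta> \<le> (\<Sum>g\<in>A. \<bar>\<theta> \<bullet> (z g - t)\<bar>)"
      using m(2) unfolding K_def by auto
    also have "\<dots> \<le> (\<Sum>g\<in>A. B)"
      using \<open>\<theta> \<in> K\<close> unfolding K_def by (intro sum_mono B) auto
    finally show "norm \<theta> \<le> (\<Sum>g\<in>A. B) / m"
      using m(1) by (simp add: field_simps)
  qed
  moreover have "closed K"
    unfolding K_def directions_def using cont by (intro closed_Int closed_span closed_Collect_le) auto
  ultimately have "compact K"
    by (simp add: compact_eq_bounded_closed)
  moreover have "0 \<in> K"
    unfolding K_def directions_def by (simp add: span_zero)
  ultimately obtain \<theta> where \<theta>: "\<theta> \<in> K" "\<forall>\<eta>\<in>K. partition_fn \<theta> \<le> partition_fn \<eta>"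
    using continuous_attains_inf[of K partition_fn] continuous_on_subset[OF cont] by blast
  have min_V: "partition_fn \<theta> \<le> partition_fn v" if "v \<in> directions" for v
    using \<theta> that unfolding K_def by (cases "partition_fn v \<le> partition_fn 0") auto
  have "partition_fn \<theta> \<le> partition_fn \<eta>" for \<eta>
  proof -
    \<comment> \<open>The component orthogonal to \<open>directions\<close> does not affect the
      value, since \<open>t\<close> lies in the affine hull.\<close>
    obtain v u where "v \<in> directions" "\<And>w. w \<in> directions \<Longrightarrow> orthogonal u w" "\<eta> = v + u"
      using orthogonal_subspace_decomp_exists[of "{z g - z h | g h. g \<in> A \<and> h \<in> A}" \<eta>]
      unfolding directions_def by blast
    then have "u \<in> directions\<^sup>\<bottom>"
      by (auto simp: orthogonal_comp_def orthogonal_commute)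
    moreover have "t \<in> affine hull (convex hull (z ` A))"
      using t rel_interior_subset hull_inc by (metis subsetD)
    ultimately have "partition_fn \<eta> = partition_fn v"
      using partition_fn_invariant \<open>\<eta> = v + u\<close> by simp
    then show ?thesis
      using min_V \<open>v \<in> directions\<close> by simp
  qed
  then show ?thesis
    using \<theta>(1) unfolding K_def by blast
qed

lemma ex_minimiser_iff:
  "(\<exists>\<theta>\<in>directions. \<forall>\<eta>. partition_fn \<theta> \<le> partition_fn \<eta>) \<longleftrightarrow>
    t \<in> rel_interior (convex hull (z ` A))"
  using minimiser_imp_rel_interior rel_interior_imp_minimiser by blast

end

section \<open>Application to labeled graphs\<close>

lemma finite_labeled_graphs: "finite (labeled_graphs k)"
proof -
  have "labeled_graphs k \<subseteq> Pow (Pow {1..k})"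
    unfolding labeled_graphs_def by auto
  then show ?thesis
    by (rule finite_subset) simp
qed

(* For t outside the affine hull of C and u in the orthogonal complement of V the
   likelihood picks up a factor exp (u \<bullet> (t - z g)), which is 1 for all such u only if t
   lies in affine hull C. Hence the premise of the last conjunct. *)

theorem theorem1:
  fixes k :: nat
    and z :: "nat set set \<Rightarrow> real ^ 'n"
    and t :: "real ^ 'n"
    and C V :: "(real ^ 'n) set"
    and L l :: "real ^ 'n \<Rightarrow> real"
  assumes "k \<ge> 1"
    and C_eq: "C = convex hull (z ` labeled_graphs k)"
    and V_eq: "V = span {z g1 - z g2 | g1 g2. g1 \<in> labeled_graphs k \<and> g2 \<in> labeled_graphs k}"
    and L_eq: "L = (\<lambda>\<theta>. exp (\<theta> \<bullet> t) / (\<Sum>g\<in>labeled_graphs k. exp (\<theta> \<bullet> z g)))"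
    and l_eq: "l = (\<lambda>\<theta>. ln (L \<theta>))"
  shows
    "(aff_dim C = int CARD('n) \<longrightarrow>
        strictly_concave l \<and>
        ((\<exists>\<theta>. ereal (L \<theta>) = (SUP \<eta>. ereal (L \<eta>))) \<longleftrightarrow> t \<in> interior C) \<and>
        (\<forall>\<theta> \<theta>'. ereal (L \<theta>) = (SUP \<eta>. ereal (L \<eta>)) \<longrightarrow>
                ereal (L \<theta>') = (SUP \<eta>. ereal (L \<eta>)) \<longrightarrow> \<theta> = \<theta>')) \<and>
     (aff_dim C < int CARD('n) \<longrightarrow>
        concave_on UNIV l \<and> \<not> strictly_concave l \<and>
        ((\<exists>\<theta>\<in>V. ereal (L \<theta>) = (SUP \<eta>. ereal (L \<eta>))) \<longleftrightarrow> t \<in> rel_interior C) \<and>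
        (\<forall>\<theta>\<in>V. \<forall>\<theta>'\<in>V. ereal (L \<theta>) = (SUP \<eta>. ereal (L \<eta>)) \<longrightarrow>
                ereal (L \<theta>') = (SUP \<eta>. ereal (L \<eta>)) \<longrightarrow> \<theta> = \<theta>') \<and>
        (t \<in> affine hull C \<longrightarrow> (\<forall>\<theta>. \<forall>u\<in>V\<^sup>\<bottom>. L \<theta> = L (\<theta> + u))))"
proof -
  interpret exponential_family "labeled_graphs k" z t
    by standard (auto simp: finite_labeled_graphs labeled_graphs_def)
  have V: "V = directions"
    unfolding V_eq directions_def ..
  have L: "L \<theta> = inverse (partition_fn \<theta>)" for \<theta>
    unfolding L_eq by (rule likelihood_eq)
  have l: "l \<theta> = - ln (partition_fn \<theta>)" for \<theta>
    unfolding l_eq L by (simp add: ln_inverse partition_fn_pos)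
  \<comment> \<open>Taking reciprocals of positive values reverses the order, so likelihood
    maximisers are minimisers of \<open>partition_fn\<close>.\<close>
  have sup_iff: "ereal (L \<theta>) = (SUP \<eta>. ereal (L \<eta>)) \<longleftrightarrow> (\<forall>\<eta>. partition_fn \<theta> \<le> partition_fn \<eta>)" for \<theta>
    using ereal_eq_SUP_iff[of L \<theta>] by (simp add: L partition_fn_pos)
  have dim_V: "int (dim V) = aff_dim C"
    unfolding V C_eq by (rule dim_directions)
  have sub_V: "subspace V"
    unfolding V_eq by (rule subspace_span)
  have unique: "\<forall>\<theta>\<in>V. \<forall>\<theta>'\<in>V. ereal (L \<theta>) = (SUP \<eta>. ereal (L \<eta>)) \<longrightarrow>
      ereal (L \<theta>') = (SUP \<eta>. ereal (L \<eta>)) \<longrightarrow> \<theta> = \<theta>'"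
    unfolding sup_iff using minimiser_unique subspace_diff[OF sub_V] V by blast
  have exists: "(\<exists>\<theta>\<in>V. ereal (L \<theta>) = (SUP \<eta>. ereal (L \<eta>))) \<longleftrightarrow> t \<in> rel_interior C"
    unfolding sup_iff V C_eq by (rule ex_minimiser_iff)
  show ?thesis
  proof (intro conjI impI)
    assume full: "aff_dim C = int CARD('n)"
    then have "V = UNIV"
      using dim_V sub_V dim_eq_full[of V] span_eq_iff[of V] by simp
    then show "strictly_concave l"
      unfolding strictly_concave_def l
      using ln_partition_fn_strictly_convex V by fastforce
    have "rel_interior C = interior C"
      using full by (intro interior_rel_interior) simp
    then show "(\<exists>\<theta>. ereal (L \<theta>) = (SUP \<eta>. ereal (L \<eta>))) \<longleftrightarrow> t \<in> interior C"
      using exists \<open>V = UNIV\<close> by simp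
    show "\<forall>\<theta> \<theta>'. ereal (L \<theta>) = (SUP \<eta>. ereal (L \<eta>)) \<longrightarrow>
        ereal (L \<theta>') = (SUP \<eta>. ereal (L \<eta>)) \<longrightarrow> \<theta> = \<theta>'"
      using unique \<open>V = UNIV\<close> by simp
  next
    assume deficient: "aff_dim C < int CARD('n)"
    have "convex_on UNIV (\<lambda>\<theta>. ln (partition_fn \<theta>))"
    proof (intro convex_onI)
      fix s :: real and x y :: "real ^ 'n"
      assume "0 < s" "s < 1"
      then show "ln (partition_fn ((1 - s) *\<^sub>R x + s *\<^sub>R y))
          \<le> (1 - s) * ln (partition_fn x) + s * ln (partition_fn y)"
        using ln_partition_fn_convex[of "1 - s" x y] by simp
    qed simp
    then show "concave_on UNIV l"
      unfolding concave_on_def l by simp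
    show "\<not> strictly_concave l"
    proof
      assume strict: "strictly_concave l"
      \<comment> \<open>Such a vector exists because \<open>V\<close> has dimension less than that
        of the whole space.\<close>
      obtain u where "u \<noteq> 0" and u: "\<And>v. v \<in> span V \<Longrightarrow> orthogonal u v"
        using orthogonal_to_subspace_exists[of V] deficient dim_V by auto
      then have perp: "a *\<^sub>R u \<in> directions\<^sup>\<bottom>" for a
        unfolding V[symmetric]
        by (auto simp: orthogonal_comp_def orthogonal_def span_base inner_commute)
      obtain h where "h \<in> labeled_graphs k" using A_nonempty by auto
      then have affine: "l (a *\<^sub>R u) = l 0 - a * (u \<bullet> (z h - t))" for a
        unfolding l using ln_partition_fn_add_orthogonal[OF perp, of h 0 a] by simp
      \<comment> \<open>Since \<open>l\<close> is affine on the line through 0 and \<open>u\<close>,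
        its value at their midpoint is exactly the average, contradicting strictness.\<close>
      have "l ((1/2) *\<^sub>R (0::real^'n) + (1 - 1/2) *\<^sub>R u) > (1/2) * l 0 + (1 - 1/2) * l u"
        using strict[unfolded strictly_concave_def, rule_format, of 0 u "1/2"] \<open>u \<noteq> 0\<close> by simp
      then show False
        using affine[of "1/2"] affine[of 1] by simp
    qed
    show "(\<exists>\<theta>\<in>V. ereal (L \<theta>) = (SUP \<eta>. ereal (L \<eta>))) \<longleftrightarrow> t \<in> rel_interior C"
      by (rule exists)
    show "\<forall>\<theta>\<in>V. \<forall>\<theta>'\<in>V. ereal (L \<theta>) = (SUP \<eta>. ereal (L \<eta>)) \<longrightarrow>
        ereal (L \<theta>') = (SUP \<eta>. ereal (L \<eta>)) \<longrightarrow> \<theta> = \<theta>'"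
      by (rule unique)
    assume "t \<in> affine hull C"
    then show "\<forall>\<theta>. \<forall>u\<in>V\<^sup>\<bottom>. L \<theta> = L (\<theta> + u)"
      unfolding L V C_eq using partition_fn_invariant by simp
  qed
qed

end
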